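(* Let $Q=[-1,1]^n$ be the unit $\infty$-norm ball, $\psi(x)=\tfrac12\|x\|^2$, and $\varepsilon\ge0$. Then $$\mathbb{P}(\mathrm{ER}^c(\varepsilon))\ \ge\ 1-\exp\Big(-\sqrt{\tfrac{2}{\pi e}}\;n\varepsilon\Big),$$ and for $\varepsilon\le\sqrt{\frac{\pi e}{2}}\,\frac{1}{2n}$, $$\mathbb{P}(\mathrm{ER}^c(\varepsilon))\ \ge\ \frac{1}{\sqrt{2\pi e}}\,n\varepsilon.$$
   Context: $\|\cdot\|$ is the Euclidean norm. Let $g\sim\mathcal N(0,I_n)$. (LP): minimize $-g\cdot x$ over $x\in Q$. $(P_\varepsilon)$: minimize $-g\cdot x+\varepsilon\psi(x)$ over $x\in Q$. With probability 1, (LP) has a unique solution $z^\star$, a vertex of $Q$. $\mathrm{ER}(\varepsilon)$ is the event that $z^\star$ is also a solution of $(P_\varepsilon)$, and $\mathrm{ER}^c(\varepsilon)$ is its complement. *)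

theory Defs
  imports "HOL-Probability.Probability"
begin

text \<open>Density of the standard Gaussian distribution \<open>N(0, I\<^sub>n)\<close> with respect to Lebesgue
  measure on \<open>real ^ 'n\<close>, where \<open>n = CARD('n)\<close>.\<close>

definition std_gaussian_density :: "real ^ 'n \<Rightarrow> real" where
  "std_gaussian_density x =
     (2 * pi) powr (- real CARD('n) / 2) * exp (- (norm x)\<^sup>2 / 2)"

definition std_gaussian_vector :: "'a measure \<Rightarrow> ('a \<Rightarrow> real ^ 'n) \<Rightarrow> bool" where
  "std_gaussian_vector M g \<longleftrightarrow>
     distributed M lborel g (\<lambda>x. ennreal (std_gaussian_density x))"

definition LP_solution :: "(real ^ 'n) set \<Rightarrow> real ^ 'n \<Rightarrow> real ^ 'n \<Rightarrow> bool" where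
  "LP_solution Q c z \<longleftrightarrow> is_arg_min (\<lambda>x. - (c \<bullet> x)) (\<lambda>x. x \<in> Q) z"

definition P_solution ::
  "(real ^ 'n) set \<Rightarrow> (real ^ 'n \<Rightarrow> real) \<Rightarrow> real \<Rightarrow> real ^ 'n \<Rightarrow> real ^ 'n \<Rightarrow> bool" where
  "P_solution Q \<psi> \<epsilon> c z \<longleftrightarrow> is_arg_min (\<lambda>x. - (c \<bullet> x) + \<epsilon> * \<psi> x) (\<lambda>x. x \<in> Q) z"

text \<open>The event that the unique solution of the linear program also solves the regularized
  problem. The unique solution exists only almost surely; outcomes without a unique solution are
  put into the event, so that its complement consists only of outcomes where the unique solution
  exists and fails to solve the regularized problem.\<close>

definition ER ::
  "'a measure \<Rightarrow> ('a \<Rightarrow> real ^ 'n) \<Rightarrow> (real ^ 'n) set \<Rightarrow> (real ^ 'n \<Rightarrow> real) \<Rightarrow> real \<Rightarrow> 'a set" where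
  "ER M g Q \<psi> \<epsilon> =
     {\<omega> \<in> space M. \<forall>z. {y. LP_solution Q (g \<omega>) y} = {z} \<longrightarrow> P_solution Q \<psi> \<epsilon> (g \<omega>) z}"

end

theory Submission
  imports Defs "HOL-Real_Asymp.Real_Asymp"
begin

text \<open>Both problems separate over the coordinates. The linear program has a unique solution exactly
  when no \<open>g\<^sub>i\<close> vanishes; the solution is then the vector of signs, and it solves the regularized
  problem iff \<open>\<epsilon> \<le> \<bar>g\<^sub>i\<bar>\<close> for every \<open>i\<close>. By independence the probability of this is
  \<open>P(\<bar>N\<bar> \<ge> \<epsilon>)\<^sup>n\<close> for a standard normal \<open>N\<close>. With \<open>c = sqrt (2 / (\<pi> e))\<close>, twice the density at \<open>1\<close>, one has
  \<open>P(\<bar>N\<bar> \<ge> \<epsilon>) \<le> 1 - c \<epsilon> \<le> exp (- c \<epsilon>)\<close> for \<open>\<epsilon> \<le> 1\<close>, whereas for \<open>\<epsilon> > 1\<close> the Gaussian tail bound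
  \<open>exp (- \<epsilon>\<^sup>2 / 2)\<close> suffices because \<open>c \<le> 1 / 2\<close>.\<close>

section \<open>Separable minimization and its solutions on the cube\<close>

lemma is_arg_min_separable:
  fixes h :: "'n::finite \<Rightarrow> 'b \<Rightarrow> 'c::linordered_ab_group_add" and z :: "'b ^ 'n"
  shows "is_arg_min (\<lambda>x. \<Sum>i\<in>UNIV. h i (x $ i)) (\<lambda>x. \<forall>i. x $ i \<in> A i) z
    \<longleftrightarrow> (\<forall>i. is_arg_min (h i) (\<lambda>t. t \<in> A i) (z $ i))" (is "?L \<longleftrightarrow> ?R")
proof
  assume L: ?L
  show ?R
  proof (rule allI, rule ccontr)
    fix i
    assume "\<not> is_arg_min (h i) (\<lambda>t. t \<in> A i) (z $ i)"
    moreover have zA: "z $ j \<in> A j" for j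
      using L by (simp add: is_arg_min_def)
    ultimately obtain t where t: "t \<in> A i" "h i t < h i (z $ i)"
      by (auto simp: is_arg_min_def)
    \<comment> \<open>Exchange argument: altering only coordinate \<open>i\<close> stays feasible
      and lowers only the \<open>i\<close>-th summand.\<close>
    define y where "y = (\<chi> j. if j = i then t else z $ j)"
    have "(\<Sum>j\<in>UNIV. h j (y $ j)) < (\<Sum>j\<in>UNIV. h j (z $ j))"
      by (rule sum_strict_mono_ex1) (use t in \<open>auto simp: y_def\<close>)
    moreover have "y $ j \<in> A j" for j
      using t zA by (simp add: y_def)
    ultimately show False
      using L by (auto simp: is_arg_min_def)
  qed
next
  assume R: ?R
  have "(\<Sum>i\<in>UNIV. h i (z $ i)) \<le> (\<Sum>i\<in>UNIV. h i (y $ i))" if "\<forall>i. y $ i \<in> A i" for y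
    by (rule sum_mono) (use R that in \<open>force simp: is_arg_min_def not_less\<close>)
  then show ?L
    using R unfolding is_arg_min_def by (meson leD)
qed

text \<open>The bound \<open>c * t\<close> \<le> \<open>\<bar>c\<bar>\<close> is attained at
  \<open>sgn c\<close>, so the minimizers are the points of equality. For \<open>c = 0\<close> these
  fill the whole interval.\<close>

lemma is_arg_min_linear_interval:
  fixes c s :: real
  shows "is_arg_min (\<lambda>t. - (c * t)) (\<lambda>t. t \<in> {-1..1}) s \<longleftrightarrow> s \<in> {-1..1} \<and> c * s = \<bar>c\<bar>"
proof -
  have le: "c * t \<le> \<bar>c\<bar>" if "t \<in> {-1..1}" for t
    using mult_left_mono[of "\<bar>t\<bar>" 1 "\<bar>c\<bar>"] that abs_le_D1[of "c * t" "\<bar>c\<bar>"] by (auto simp: abs_mult)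
  have "sgn c \<in> {-1..1}" "c * sgn c = \<bar>c\<bar>"
    by (auto simp: sgn_if)
  with le show ?thesis
    unfolding is_arg_min_def by (smt (verit, best))
qed

text \<open>For \<open>\<epsilon> > 0\<close> the parabola has its vertex at
  \<open>c / \<epsilon>\<close>, and the endpoint \<open>sgn c\<close> is optimal exactly when the
  vertex does not lie strictly inside the interval.\<close>

lemma is_arg_min_quadratic_sgn:
  fixes c \<epsilon> :: real
  assumes "c \<noteq> 0" "\<epsilon> \<ge> 0"
  shows "is_arg_min (\<lambda>t. \<epsilon> / 2 * t\<^sup>2 - c * t) (\<lambda>t. t \<in> {-1..1}) (sgn c) \<longleftrightarrow> \<epsilon> \<le> \<bar>c\<bar>"
proof -
  have sgn: "sgn c \<in> {-1..1}" "c * sgn c = \<bar>c\<bar>" "(sgn c)\<^sup>2 = 1"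
    using assms by (auto simp: sgn_if)
  show ?thesis
  proof
    assume min: "is_arg_min (\<lambda>t. \<epsilon> / 2 * t\<^sup>2 - c * t) (\<lambda>t. t \<in> {-1..1}) (sgn c)"
    show "\<epsilon> \<le> \<bar>c\<bar>"
    proof (rule ccontr)
      assume *: "\<not> \<epsilon> \<le> \<bar>c\<bar>"
      \<comment> \<open>the unconstrained minimizer\<close>
      define t where "t = c / \<epsilon>"
      have "\<epsilon> > 0"
        using * by linarith
      have t: "t \<in> {-1..1}"
        using * \<open>\<epsilon> > 0\<close> by (auto simp: t_def field_simps)
      \<comment> \<open>The objective at \<open>sgn c\<close> exceeds that at \<open>t\<close> by
        this square divided by \<open>2 * \<epsilon>\<close>.\<close>
      have "(\<epsilon> - \<bar>c\<bar>)\<^sup>2 > 0"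
        using * by simp
      then have "\<epsilon> / 2 * t\<^sup>2 - c * t < \<epsilon> / 2 - \<bar>c\<bar>"
        using \<open>\<epsilon> > 0\<close> by (simp add: t_def field_simps power2_eq_square)
      with min t show False
        by (auto simp: is_arg_min_def sgn)
    qed
  next
    assume *: "\<epsilon> \<le> \<bar>c\<bar>"
    have "\<epsilon> / 2 - \<bar>c\<bar> \<le> \<epsilon> / 2 * t\<^sup>2 - c * t" if t: "t \<in> {-1..1}" for t
    proof -
      have t1: "\<bar>t\<bar> \<le> 1"
        using t by auto
      \<comment> \<open>Makes the second factor below nonnegative. The product is the gain of
        \<open>\<bar>t\<bar>\<close> over 1 in the objective with \<open>\<bar>c\<bar>\<close> for
        \<open>c\<close>; then \<open>c * t\<close> \<le> \<open>\<bar>c * t\<bar>\<close> covers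
        either sign of \<open>t\<close>.\<close>
      have "\<epsilon> * (1 + \<bar>t\<bar>) \<le> \<bar>c\<bar> * 2"
        by (rule mult_mono) (use * t1 in auto)
      then have "0 \<le> (1 - \<bar>t\<bar>) * (\<bar>c\<bar> - \<epsilon> / 2 * (1 + \<bar>t\<bar>))"
        using t1 by simp
      also have "\<dots> = \<bar>c\<bar> - \<bar>c * t\<bar> - \<epsilon> / 2 * (1 - \<bar>t\<bar>\<^sup>2)"
        by (simp add: field_simps abs_mult power2_eq_square)
      finally show ?thesis
        by (simp add: algebra_simps)
    qed
    then show "is_arg_min (\<lambda>t. \<epsilon> / 2 * t\<^sup>2 - c * t) (\<lambda>t. t \<in> {-1..1}) (sgn c)"
      using sgn by (simp add: is_arg_min_def not_less)
  qed
qed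

lemma LP_solution_cube_iff:
  fixes c y :: "real ^ 'n"
  shows "LP_solution {x. \<forall>i. x $ i \<in> {-1..1}} c y \<longleftrightarrow> (\<forall>i. y $ i \<in> {-1..1} \<and> c $ i * y $ i = \<bar>c $ i\<bar>)"
proof -
  have "(\<lambda>x. - (c \<bullet> x)) = (\<lambda>x. \<Sum>i\<in>UNIV. - (c $ i * x $ i))"
    by (simp add: inner_vec_def sum_negf)
  then show ?thesis
    using is_arg_min_separable[of "\<lambda>i t. - (c $ i * t)" "\<lambda>_. {-1..1}" y]
    unfolding LP_solution_def is_arg_min_linear_interval mem_Collect_eq by simp
qed

lemma LP_solution_cube_unique_iff:
  fixes c z :: "real ^ 'n"
  shows "{y. LP_solution {x. \<forall>i. x $ i \<in> {-1..1}} c y} = {z}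
    \<longleftrightarrow> (\<forall>i. c $ i \<noteq> 0) \<and> z = (\<chi> i. sgn (c $ i))"
proof (intro iffI conjI allI notI)
  assume L: "{y. LP_solution {x. \<forall>i. x $ i \<in> {-1..1}} c y} = {z}"
  have uniq: "y = z" if "\<forall>i. y $ i \<in> {-1..1} \<and> c $ i * y $ i = \<bar>c $ i\<bar>" for y
    using L that LP_solution_cube_iff[of c y] by blast
  show "z = (\<chi> i. sgn (c $ i))"
    by (rule uniq[symmetric]) (auto simp: sgn_if)
  fix i
  assume "c $ i = 0"
  \<comment> \<open>With \<open>c $ i = 0\<close> the objective ignores coordinate \<open>i\<close>,
    so 1 is as good there as \<open>sgn 0 = 0\<close>: a second solution.\<close>
  then have "(\<chi> j. if j = i then 1 else sgn (c $ j)) = z"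
    by (intro uniq) (auto simp: sgn_if)
  then have "z $ i = 1"
    by auto
  with \<open>c $ i = 0\<close> \<open>z = _\<close> show False
    by simp
next
  assume R: "(\<forall>i. c $ i \<noteq> 0) \<and> z = (\<chi> i. sgn (c $ i))"
  have "t \<in> {-1..1} \<and> a * t = \<bar>a\<bar> \<longleftrightarrow> t = sgn a" if "a \<noteq> 0" for a t :: real
  proof -
    have "a * sgn a = \<bar>a\<bar>" "sgn a \<in> {-1..1}"
      by (auto simp: sgn_if)
    with that show ?thesis
      using mult_left_cancel[OF that, of t "sgn a"] by auto
  qed
  with R show "{y. LP_solution {x. \<forall>i. x $ i \<in> {-1..1}} c y} = {z}"
    unfolding set_eq_iff mem_Collect_eq LP_solution_cube_iff by (simp add: vec_eq_iff)
qed

lemma P_solution_cube_sgn_iff: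
  fixes c :: "real ^ 'n"
  assumes "\<And>i. c $ i \<noteq> 0" "\<epsilon> \<ge> 0"
  shows "P_solution {x. \<forall>i. x $ i \<in> {-1..1}} (\<lambda>x. 1 / 2 * (norm x)\<^sup>2) \<epsilon> c (\<chi> i. sgn (c $ i))
    \<longleftrightarrow> (\<forall>i. \<epsilon> \<le> \<bar>c $ i\<bar>)"
proof -
  have "(\<lambda>x. - (c \<bullet> x) + \<epsilon> * (1 / 2 * (norm x)\<^sup>2)) = (\<lambda>x. \<Sum>i\<in>UNIV. \<epsilon> / 2 * (x $ i)\<^sup>2 - c $ i * x $ i)"
    by (simp only: power2_norm_eq_inner) (simp add: inner_vec_def sum_subtractf sum_distrib_left sum_divide_distrib power2_eq_square)
  then show ?thesis
    using is_arg_min_separable[of "\<lambda>i t. \<epsilon> / 2 * t\<^sup>2 - c $ i * t" "\<lambda>_. {-1..1}" "\<chi> i. sgn (c $ i)"]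
      assms is_arg_min_quadratic_sgn
    unfolding P_solution_def mem_Collect_eq by simp
qed

text \<open>Failure means that the solution is unique but some coordinate lies below the threshold.
  Removing 0 from the second box as well makes it a subset of the first, even for
  \<open>\<epsilon> = 0\<close>, so that their measures can be subtracted.\<close>

lemma ER_cube_compl:
  fixes g :: "'a \<Rightarrow> real ^ 'n"
  assumes "\<epsilon> \<ge> 0"
  shows "space M - ER M g {x. \<forall>i. x $ i \<in> {-1..1}} (\<lambda>x. 1 / 2 * (norm x)\<^sup>2) \<epsilon> =
    (g -` {x. \<forall>i. x $ i \<in> - {0}} \<inter> space M) - (g -` {x. \<forall>i. x $ i \<in> {t. \<epsilon> \<le> \<bar>t\<bar>} - {0}} \<inter> space M)"
  using P_solution_cube_sgn_iff[OF _ assms]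
  unfolding ER_def LP_solution_cube_unique_iff by auto

section \<open>Product structure of the Gaussian measure\<close>

lemma prod_Basis_vec_real:
  "(\<Prod>b\<in>(Basis :: (real ^ 'n) set). f (x \<bullet> b)) = (\<Prod>i\<in>UNIV. f (x $ i))"
proof -
  have "bij_betw (\<lambda>i. axis i 1) UNIV (Basis :: (real ^ 'n) set)"
    by (auto simp: bij_betw_def inj_on_def axis_eq_axis Basis_vec_def)
  from prod.reindex_bij_betw[OF this, of "\<lambda>b. f (x \<bullet> b)"] show ?thesis
    by (simp add: inner_axis)
qed

lemma std_gaussian_density_eq_prod:
  fixes x :: "real ^ 'n"
  shows "std_gaussian_density x = (\<Prod>i\<in>UNIV. std_normal_density (x $ i))"
proof -
  have "(2 * pi) powr (- real CARD('n) / 2) = (1 / sqrt (2 * pi)) ^ CARD('n)"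
    by (simp add: powr_half_sqrt[symmetric] powr_minus_divide powr_powr powr_realpow[symmetric] power_one_over)
  moreover have "- (norm x)\<^sup>2 / 2 = (\<Sum>i\<in>UNIV. - (x $ i)\<^sup>2 / 2)"
    by (simp only: power2_norm_eq_inner) (simp add: inner_vec_def sum_negf sum_divide_distrib[symmetric] power2_eq_square)
  ultimately show ?thesis
    by (simp add: std_gaussian_density_def std_normal_density_def prod_dividef exp_sum power_one_over)
qed

abbreviation std_normal :: "real measure" where
  "std_normal \<equiv> density lborel (\<lambda>x. ennreal (std_normal_density x))"

lemma sets_Collect_vec_all:
  assumes "A \<in> sets borel"
  shows "{x :: real ^ 'n. \<forall>i. x $ i \<in> A} \<in> sets borel"
proof -
  have "(\<lambda>x :: real ^ 'n. x $ i) \<in> borel_measurable borel" for i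
    by (intro borel_measurable_continuous_onI continuous_intros)
  from measurable_sets[OF this assms] have "(\<lambda>x :: real ^ 'n. x $ i) -` A \<in> sets borel" for i
    by simp
  moreover have "{x :: real ^ 'n. \<forall>i. x $ i \<in> A} = (\<Inter>i. (\<lambda>x. x $ i) -` A)"
    by auto
  ultimately show ?thesis
    by (auto intro!: sets.countable_INT')
qed

text \<open>This is where independence enters: density and indicator both factor over the
  coordinates, so the integral splits into \<open>CARD('n)\<close> equal one-dimensional
  ones.\<close>

lemma std_gaussian_vector_emeasure_box:
  fixes g :: "'a \<Rightarrow> real ^ 'n"
  assumes g: "std_gaussian_vector M g" and [measurable]: "A \<in> sets borel"
  shows "emeasure M (g -` {x. \<forall>i. x $ i \<in> A} \<inter> space M) = emeasure std_normal A ^ CARD('n)"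
proof -
  have "emeasure M (g -` {x. \<forall>i. x $ i \<in> A} \<inter> space M) =
      (\<integral>\<^sup>+x. ennreal (std_gaussian_density x) * indicator {x. \<forall>i. x $ i \<in> A} x \<partial>(lborel :: (real ^ 'n) measure))"
    using g sets_Collect_vec_all[OF assms(2)] unfolding std_gaussian_vector_def
    by (intro distributed_emeasure) auto
  also have "\<dots> = (\<integral>\<^sup>+x. (\<Prod>b\<in>Basis. ennreal (std_normal_density (x \<bullet> b)) * indicator A (x \<bullet> b)) \<partial>(lborel :: (real ^ 'n) measure))"
    by (subst prod_Basis_vec_real[of "\<lambda>t. ennreal (std_normal_density t) * indicator A t"])
      (auto simp: std_gaussian_density_eq_prod prod.distrib prod_ennreal indicator_def intro!: nn_integral_cong)
  also have "\<dots> = (\<Prod>b\<in>(Basis :: (real ^ 'n) set). (\<integral>\<^sup>+t. ennreal (std_normal_density t) * indicator A t \<partial>lborel))"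
    by (rule nn_integral_lborel_prod) auto
  also have "\<dots> = emeasure std_normal A ^ CARD('n)"
    by (simp add: emeasure_density)
  finally show ?thesis .
qed

section \<open>One-dimensional Gaussian estimates\<close>

text \<open>On \<open>t\<close> \<ge> \<open>a\<close> \<ge> 1 an extra factor \<open>t\<close> only
  enlarges the integrand and gives it the explicit antiderivative \<open>?F\<close>.\<close>

lemma std_normal_tail_le:
  assumes "a \<ge> 1"
  shows "measure std_normal {t. a \<le> \<bar>t\<bar>} \<le> exp (- a\<^sup>2 / 2)"
proof -
  interpret prob_space std_normal
    by (rule prob_space_normal_density) simp
  let ?f = "\<lambda>t. ennreal (std_normal_density t) * indicator {a..} t"
  let ?F = "\<lambda>t :: real. - (sqrt (2 / pi) * exp (- t\<^sup>2 / 2))"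
  have "emeasure std_normal {t. a \<le> \<bar>t\<bar>} =
      (\<integral>\<^sup>+t. ennreal (std_normal_density t) * indicator {t. a \<le> \<bar>t\<bar>} t \<partial>lborel)"
    by (simp add: emeasure_density)
  \<comment> \<open>The two half-lines are disjoint because \<open>a > 0\<close>; by symmetry they
    carry equal mass.\<close>
  also have "\<dots> = (\<integral>\<^sup>+t. ?f t + ?f (- t) \<partial>lborel)"
    by (intro nn_integral_cong) (use assms in \<open>auto simp: indicator_def std_normal_density_def\<close>)
  also have "\<dots> = (\<integral>\<^sup>+t. ?f t \<partial>lborel) + (\<integral>\<^sup>+t. ?f (- t) \<partial>lborel)"
    by (rule nn_integral_add) auto
  also have "(\<integral>\<^sup>+t. ?f (- t) \<partial>lborel) = (\<integral>\<^sup>+t. ?f t \<partial>lborel)"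
    using nn_integral_real_affine[of ?f "-1" 0] by simp
  also have "(\<integral>\<^sup>+t. ?f t \<partial>lborel) + (\<integral>\<^sup>+t. ?f t \<partial>lborel) = (\<integral>\<^sup>+t. ?f t + ?f t \<partial>lborel)"
    by (rule nn_integral_add[symmetric]) auto
  also have "\<dots> \<le> (\<integral>\<^sup>+t. ennreal (sqrt (2 / pi) * t * exp (- t\<^sup>2 / 2)) * indicator {a..} t \<partial>lborel)"
  proof (rule nn_integral_mono)
    fix t :: real
    show "?f t + ?f t \<le> ennreal (sqrt (2 / pi) * t * exp (- t\<^sup>2 / 2)) * indicator {a..} t"
    proof (cases "a \<le> t")
      case True
      have "std_normal_density t + std_normal_density t = sqrt (2 / pi) * 1 * exp (- t\<^sup>2 / 2)"
        by (simp add: std_normal_density_def real_sqrt_divide real_sqrt_mult field_simps)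
      also have "\<dots> \<le> sqrt (2 / pi) * t * exp (- t\<^sup>2 / 2)"
        using True assms by (intro mult_right_mono mult_left_mono) auto
      finally show ?thesis
        using True by (simp add: ennreal_plus[symmetric] ennreal_leI del: ennreal_plus)
    qed simp
  qed
  also have "\<dots> = ennreal (0 - ?F a)"
  proof (rule nn_integral_FTC_atLeast)
    show "DERIV ?F x :> sqrt (2 / pi) * x * exp (- x\<^sup>2 / 2)" for x
      by (auto intro!: derivative_eq_intros)
    show "0 \<le> sqrt (2 / pi) * x * exp (- x\<^sup>2 / 2)" if "a \<le> x" for x
      using that assms by auto
    show "(?F \<longlongrightarrow> 0) at_top"
      by real_asymp
  qed simp
  finally have "measure std_normal {t. a \<le> \<bar>t\<bar>} \<le> sqrt (2 / pi) * exp (- a\<^sup>2 / 2)"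
    by (simp add: emeasure_eq_measure)
  also have "\<dots> \<le> 1 * exp (- a\<^sup>2 / 2)"
    using pi_gt3 by (intro mult_right_mono) auto
  finally show ?thesis
    by simp
qed

text \<open>After squaring, this is the numerical fact that \<open>pi * exp 1\<close> is at least
  8.\<close>

lemma sqrt_two_div_pi_e_le_half: "sqrt (2 / (pi * exp 1)) \<le> 1 / 2"
proof -
  have "3.1 * 2.7 \<le> pi * exp 1"
    using pi_approx e_approx_32 by (intro mult_mono) (auto simp: abs_if split: if_splits)
  then have "2 / (pi * exp 1) \<le> (1 / 2)\<^sup>2"
    by (simp add: field_simps power2_eq_square)
  then show ?thesis
    by (intro real_le_lsqrt) auto
qed

lemma std_normal_tail_le_exp_linear:
  assumes "a \<ge> 0"
  shows "measure std_normal {t. a \<le> \<bar>t\<bar>} \<le> exp (- (sqrt (2 / (pi * exp 1)) * a))"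
proof (cases "a \<le> 1")
  case True
  interpret prob_space std_normal
    by (rule prob_space_normal_density) simp
  \<comment> \<open>The normal density at 1, its minimum on [-1,1]. Since \<open>a\<close> \<le> 1,
    the interval \<open>{-a<..<a}\<close> of length \<open>2 * a\<close> has mass at least
    \<open>2 * ?d * a\<close>.\<close>
  let ?d = "exp (- 1 / 2) / sqrt (2 * pi)"
  have "exp 1 = (exp (1 / 2) :: real)\<^sup>2"
    by (simp add: exp_double[symmetric])
  then have d: "2 * ?d = sqrt (2 / (pi * exp 1))"
    by (simp add: real_sqrt_divide real_sqrt_mult exp_minus field_simps)
  have "ennreal ?d * ennreal (2 * a) = (\<integral>\<^sup>+t. ennreal ?d * indicator {-a<..<a} t \<partial>lborel)"
    using assms by (simp add: nn_integral_cmult_indicator)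
  also have "\<dots> \<le> (\<integral>\<^sup>+t. ennreal (std_normal_density t) * indicator {-a<..<a} t \<partial>lborel)"
  proof (rule nn_integral_mono)
    fix t :: real
    have "?d \<le> std_normal_density t" if "\<bar>t\<bar> < a"
    proof -
      have "t\<^sup>2 \<le> 1"
        using that True by (simp add: abs_square_le_1)
      then show ?thesis
        by (simp add: std_normal_density_def divide_right_mono)
    qed
    then show "ennreal ?d * indicator {-a<..<a} t \<le> ennreal (std_normal_density t) * indicator {-a<..<a} t"
      by (auto simp: indicator_def intro!: ennreal_leI)
  qed
  also have "\<dots> = emeasure std_normal {-a<..<a}"
    by (simp add: emeasure_density)
  finally have "2 * ?d * a \<le> measure std_normal {-a<..<a}"
    using assms by (simp add: emeasure_eq_measure ennreal_mult[symmetric] mult_ac)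
  moreover have "{t. a \<le> \<bar>t\<bar>} = space std_normal - {-a<..<a}"
    by auto
  then have "measure std_normal {t. a \<le> \<bar>t\<bar>} = 1 - measure std_normal {-a<..<a}"
    using prob_compl[of "{-a<..<a}"] by simp
  ultimately have "measure std_normal {t. a \<le> \<bar>t\<bar>} \<le> 1 + - (sqrt (2 / (pi * exp 1)) * a)"
    unfolding d by linarith
  also have "\<dots> \<le> exp (- (sqrt (2 / (pi * exp 1)) * a))"
    by (rule exp_ge_add_one_self)
  finally show ?thesis .
next
  case False
  have "sqrt (2 / (pi * exp 1)) * a \<le> 1 / 2 * a"
    using assms sqrt_two_div_pi_e_le_half by (rule mult_right_mono[rotated])
  also have "\<dots> \<le> a\<^sup>2 / 2"
    using False by (simp add: power2_eq_square)
  finally have "exp (- a\<^sup>2 / 2) \<le> exp (- (sqrt (2 / (pi * exp 1)) * a))"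
    by simp
  with std_normal_tail_le[of a] False show ?thesis
    by linarith
qed

text \<open>Turns the exponential bound into the linear one, at the cost of a factor 2.\<close>

lemma half_le_one_minus_exp_minus:
  fixes y :: real
  assumes "0 \<le> y" "y \<le> 1"
  shows "y / 2 \<le> 1 - exp (- y)"
proof -
  have "exp (- y) = 1 / exp y"
    by (simp add: exp_minus field_simps)
  also have "\<dots> \<le> 1 / (1 + y)"
    using assms exp_ge_add_one_self[of y] by (intro divide_left_mono) auto
  \<comment> \<open>Clearing denominators leaves \<open>y * y\<close> \<le>
    \<open>y\<close>.\<close>
  also have "\<dots> \<le> 1 - y / 2"
    using assms mult_left_mono[of y 1 y] by (simp add: field_simps)
  finally show ?thesis
    by simp
qed

section \<open>Assembling the two bounds\<close>

theorem proposition4p1: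
  fixes M :: "'a measure"
    and g :: "'a \<Rightarrow> real ^ 'n"
    and Q :: "(real ^ 'n) set"
    and \<psi> :: "real ^ 'n \<Rightarrow> real"
    and \<epsilon> :: real
  assumes "prob_space M"
    and "std_gaussian_vector M g"
    and "Q = {x. \<forall>i. x $ i \<in> {-1..1}}"
    and "\<psi> = (\<lambda>x. 1 / 2 * (norm x)\<^sup>2)"
    and "\<epsilon> \<ge> 0"
  shows "measure M (space M - ER M g Q \<psi> \<epsilon>)
           \<ge> 1 - exp (- (sqrt (2 / (pi * exp 1)) * real CARD('n) * \<epsilon>))
       \<and> (\<epsilon> \<le> sqrt (pi * exp 1 / 2) * (1 / (2 * real CARD('n))) \<longrightarrow>
            measure M (space M - ER M g Q \<psi> \<epsilon>)
              \<ge> 1 / sqrt (2 * pi * exp 1) * real CARD('n) * \<epsilon>)"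
proof -
  interpret M: prob_space M
    by (rule assms)
  interpret N: prob_space std_normal
    by (rule prob_space_normal_density) simp
  let ?n = "real CARD('n)" and ?c = "sqrt (2 / (pi * exp 1))"
  let ?box = "\<lambda>A. g -` {x. \<forall>i. x $ i \<in> A} \<inter> space M" and ?A = "{t :: real. \<epsilon> \<le> \<bar>t\<bar>} - {0}"
  have box: "measure M (?box A) = measure std_normal A ^ CARD('n)" if "A \<in> sets borel" for A
    using std_gaussian_vector_emeasure_box[OF assms(2) that]
    by (simp add: M.emeasure_eq_measure N.emeasure_eq_measure ennreal_power)
  have g: "g \<in> measurable M borel"
    using assms(2) by (auto simp: std_gaussian_vector_def distributed_def)
  have sets: "?box A \<in> sets M" if "A \<in> sets borel" for A
    using g sets_Collect_vec_all[OF that] by (rule measurable_sets)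
  \<comment> \<open>Points are null sets, so the box of vectors without zero coordinates has
    probability 1.\<close>
  have "emeasure std_normal {0} = 0"
    by (simp add: emeasure_density nn_integral_null_delta)
  then have "measure std_normal (- {0}) = 1"
    using N.prob_compl[of "{0}"] by (simp add: N.emeasure_eq_measure Compl_eq_Diff_UNIV)
  moreover have "space M - ER M g Q \<psi> \<epsilon> = ?box (- {0}) - ?box ?A"
    unfolding assms(3,4) by (rule ER_cube_compl[OF assms(5)])
  moreover have "measure M (?box (- {0}) - ?box ?A) = measure M (?box (- {0})) - measure M (?box ?A)"
    by (rule M.finite_measure_Diff[OF sets sets]) auto
  moreover have "measure M (?box (- {0})) = measure std_normal (- {0}) ^ CARD('n)"
    "measure M (?box ?A) = measure std_normal ?A ^ CARD('n)"
    by (rule box, simp)+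
  ultimately have ER: "measure M (space M - ER M g Q \<psi> \<epsilon>) = 1 - measure std_normal ?A ^ CARD('n)"
    by (simp only: power_one)
  have "measure std_normal ?A \<le> measure std_normal {t. \<epsilon> \<le> \<bar>t\<bar>}"
    by (rule N.finite_measure_mono) auto
  also have "\<dots> \<le> exp (- (?c * \<epsilon>))"
    by (rule std_normal_tail_le_exp_linear[OF assms(5)])
  finally have "measure std_normal ?A ^ CARD('n) \<le> exp (- (?c * \<epsilon>)) ^ CARD('n)"
    by (rule power_mono) simp
  also have "\<dots> = exp (- (?c * ?n * \<epsilon>))"
    by (simp add: exp_of_nat_mult[symmetric] mult_ac)
  finally have first: "1 - exp (- (?c * ?n * \<epsilon>)) \<le> measure M (space M - ER M g Q \<psi> \<epsilon>)"
    by (simp add: ER)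
  moreover have "1 / sqrt (2 * pi * exp 1) * ?n * \<epsilon> \<le> 1 - exp (- (?c * ?n * \<epsilon>))"
    if "\<epsilon> \<le> sqrt (pi * exp 1 / 2) * (1 / (2 * ?n))"
  proof -
    \<comment> \<open>The square root in the threshold is the reciprocal of \<open>?c\<close>, so
      the exponent is at most 1/2, inside the range of the linear bound.\<close>
    have "?c * ?n * \<epsilon> \<le> ?c * ?n * (sqrt (pi * exp 1 / 2) * (1 / (2 * ?n)))"
      using that by (intro mult_left_mono) auto
    also have "\<dots> = 1 / 2"
      by (simp add: real_sqrt_divide real_sqrt_mult)
    finally have "?c * ?n * \<epsilon> / 2 \<le> 1 - exp (- (?c * ?n * \<epsilon>))"
      using assms(5) by (intro half_le_one_minus_exp_minus) auto
    \<comment> \<open>The constant of the second claim is \<open>?c\<close> with the factor 1/2 from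
      the linear bound.\<close>
    moreover have "1 / sqrt (2 * pi * exp 1) = ?c / 2"
      by (simp add: real_sqrt_divide real_sqrt_mult field_simps)
    then have "1 / sqrt (2 * pi * exp 1) * ?n * \<epsilon> = ?c * ?n * \<epsilon> / 2"
      by (simp only: times_divide_eq_left)
    ultimately show ?thesis
      by (simp only:)
  qed
  ultimately show ?thesis
    by linarith
qed

end
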